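(* Consider the iterative velocity limiter, defined in the context, on one high-order element with $N_p$ solution points, started from data with positive density and temperature at all points. 1. The limiter is conservative: at each iteration $\sum_{a=1}^{N_p}\mathcal P_a\hat{\bf U}_a$ is unchanged. 2. The limiter is pointwise entropy dissipative: at each iteration and at each solution point $a$, the mathematical entropy $\mathcal S$ does not increase. 3. For every velocity component $l\in\{1,2,3\}$ and every $m\ge1$, $$\max_a\,(V_l)^{(m)}_a-\min_a\,(V_l)^{(m)}_a\ \le\ \left(\max_a\,(V_l)^{(0)}_a-\min_a\,(V_l)^{(0)}_a\right)\prod_{n=1}^m\left(1-\frac{(\theta^v_l)^{(n)}}{\max_a\left(\mathcal P_aJ_a\frac{\rho_a}{\rho_{\min}}\right)}\right).$$ 4. The iterative method converges, and upon convergence the velocity components at all solution points satisfy $$\left|(V_l)_a-\bar{\bar V}_l\right|\le\frac{\bar{\bar\rho}_H\,h\,\bar{\bar T}_H}{\mu}\qquad\text{for all }a\text{ and }l.$$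
   Context: Gas: ${\bf U}=(\rho,\rho V_1,\rho V_2,\rho V_3,\rho E)$, $E=\frac{R_gT}{\gamma-1}+\frac12\|\vec V\|^2$, $R_g>0$, $\gamma>1$; $s=\frac{R_g}{\gamma-1}\log T-R_g\log\rho$ (up to a constant), $\mathcal S=-\rho s$. On the element, the solution points are indexed by $a=1,\dots,N_p$, with mass-matrix weight $\mathcal P_a>0$, Jacobian $J_a>0$, and $\hat{\bf U}_a=J_a{\bf U}_a$. For a quantity $q$, $\bar{\bar q}=\frac1{N_p}\sum_aq_a$. $\rho_{\min}=\min_a\rho_a$; at point $a$, $\bar{\bar\rho}_H$ is the harmonic average of $\rho_a$ and $\bar{\bar\rho}$, and $\bar{\bar T}_H$ the harmonic average of $T_a$ and $\bar{\bar T}$. $\mu>0$ is the physical viscosity coefficient and $h>0$ is a reference length of the element. One iteration of the limiter. Using the current values (those at iteration $m-1$), for each component $l$ and point $a$: if $|(V_l)_a-\bar{\bar V}_l|>\bar{\bar\rho}_Hh\bar{\bar T}_H/\mu$, set $$(\theta^v_l)_a=\mathcal P_aJ_a\frac{\rho_a}{\rho_{\min}}\left(1-\frac{\bar{\bar\rho}_H\,h\,\bar{\bar T}_H}{\mu\,|(V_l)_a-\bar{\bar V}_l|}\right),$$ otherwise $(\theta^v_l)_a=0$. Set $$\theta^v_l=(\theta_l^v)^{(m)}=\min\left(\max_a(\theta^v_l)_a,\ \min_a\left(\mathcal P_aJ_a\frac{\rho_a}{\rho_{\min}}\right)\right).$$ Then update at every point $$\hat{\bf U}_a\leftarrow\hat{\bf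 U}_a+\frac1{\mathcal P_a}\,\rho_{\min}\begin{bmatrix}0&0&0\\ \theta^v_1&0&0\\ 0&\theta^v_2&0\\ 0&0&\theta^v_3\\ \theta^v_1\bar{\bar V}_1&\theta^v_2\bar{\bar V}_2&\theta^v_3\bar{\bar V}_3\end{bmatrix}\left(\bar{\bar{\vec V}}-\vec V_a\right),$$ which gives $(V_l)_a^{(m)}-\bar{\bar V}_l^{(m-1)}=\left((V_l)_a^{(m-1)}-\bar{\bar V}_l^{(m-1)}\right)\left(1-\frac{(\theta^v_l)^{(m)}}{J_a\mathcal P_a}\frac{\rho_{\min}}{\rho_a}\right)$ and leaves the density unchanged. Averages are recomputed and the procedure is repeated. Superscript $(m)$ denotes values after $m$ iterations, $(0)$ the initial data. *)

theory Defs
  imports "HOL-Analysis.Analysis"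
begin

text \<open>
  A gas state is the vector of conserved variables \<open>(\<rho>, \<rho> V\<^sub>1, \<rho> V\<^sub>2, \<rho> V\<^sub>3, \<rho> E)\<close>
  in \<^typ>\<open>real^5\<close>.  The solution points of the element are the elements of a finite index type
  \<open>'p\<close>, so \<open>N\<^sub>p = CARD('p)\<close>.
\<close>

definition conserved :: "real \<Rightarrow> real \<Rightarrow> real \<Rightarrow> real^3 \<Rightarrow> real \<Rightarrow> real^5" where
  "conserved Rg \<gamma> \<rho> V T =
     (let E = Rg * T / (\<gamma> - 1) + (norm V)\<^sup>2 / 2
      in vector [\<rho>, \<rho> * V$1, \<rho> * V$2, \<rho> * V$3, \<rho> * E])"

definition mass_density :: "real^5 \<Rightarrow> real" where
  "mass_density U = U$1"

definition velocity :: "real^5 \<Rightarrow> real^3" where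
  "velocity U = vector [U$2 / mass_density U, U$3 / mass_density U, U$4 / mass_density U]"

definition total_energy :: "real^5 \<Rightarrow> real" where
  "total_energy U = U$5 / mass_density U"

definition temperature :: "real \<Rightarrow> real \<Rightarrow> real^5 \<Rightarrow> real" where
  "temperature Rg \<gamma> U = (\<gamma> - 1) / Rg * (total_energy U - (norm (velocity U))\<^sup>2 / 2)"

text \<open>The parameter \<open>s0\<close> is the free additive constant of the thermodynamic entropy.\<close>

definition thermo_entropy :: "real \<Rightarrow> real \<Rightarrow> real \<Rightarrow> real^5 \<Rightarrow> real" where
  "thermo_entropy Rg \<gamma> s0 U =
     Rg / (\<gamma> - 1) * ln (temperature Rg \<gamma> U) - Rg * ln (mass_density U) + s0"

definition math_entropy :: "real \<Rightarrow> real \<Rightarrow> real \<Rightarrow> real^5 \<Rightarrow> real" where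
  "math_entropy Rg \<gamma> s0 U = - mass_density U * thermo_entropy Rg \<gamma> s0 U"

definition avg :: "('p::finite \<Rightarrow> 'v::real_vector) \<Rightarrow> 'v" where
  "avg q = (\<Sum>a\<in>UNIV. q a) /\<^sub>R real CARD('p)"

definition harmonic_mean :: "real \<Rightarrow> real \<Rightarrow> real" where
  "harmonic_mean x y = 2 / (1 / x + 1 / y)"

text \<open>Physical states \<open>U\<^sub>a\<close> from the Jacobian-weighted states \<open>J\<^sub>a U\<^sub>a\<close>.\<close>

definition physical :: "('p \<Rightarrow> real) \<Rightarrow> ('p \<Rightarrow> real^5) \<Rightarrow> 'p \<Rightarrow> real^5" where
  "physical J Uhat a = Uhat a /\<^sub>R J a"

definition rho_min :: "('p::finite \<Rightarrow> real^5) \<Rightarrow> real" where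
  "rho_min U = (MIN a. mass_density (U a))"

definition point_weight ::
    "('p::finite \<Rightarrow> real) \<Rightarrow> ('p \<Rightarrow> real) \<Rightarrow> ('p \<Rightarrow> real^5) \<Rightarrow> 'p \<Rightarrow> real" where
  "point_weight P J U a = P a * J a * (mass_density (U a) / rho_min U)"

definition velocity_bound ::
    "real \<Rightarrow> real \<Rightarrow> real \<Rightarrow> real \<Rightarrow> ('p::finite \<Rightarrow> real^5) \<Rightarrow> 'p \<Rightarrow> real" where
  "velocity_bound Rg \<gamma> \<mu> h U a =
     harmonic_mean (mass_density (U a)) (avg (\<lambda>b. mass_density (U b))) * h *
     harmonic_mean (temperature Rg \<gamma> (U a)) (avg (\<lambda>b. temperature Rg \<gamma> (U b))) / \<mu>"

definition velocity_deviation :: "('p::finite \<Rightarrow> real^5) \<Rightarrow> 'p \<Rightarrow> 3 \<Rightarrow> real" where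
  "velocity_deviation U a l = \<bar>velocity (U a) $ l - avg (\<lambda>b. velocity (U b) $ l)\<bar>"

definition theta_point ::
    "real \<Rightarrow> real \<Rightarrow> real \<Rightarrow> real \<Rightarrow> ('p::finite \<Rightarrow> real) \<Rightarrow> ('p \<Rightarrow> real) \<Rightarrow>
     ('p \<Rightarrow> real^5) \<Rightarrow> 'p \<Rightarrow> 3 \<Rightarrow> real" where
  "theta_point Rg \<gamma> \<mu> h P J U a l =
     (if velocity_deviation U a l > velocity_bound Rg \<gamma> \<mu> h U a
      then point_weight P J U a * (1 - velocity_bound Rg \<gamma> \<mu> h U a / velocity_deviation U a l)
      else 0)"

definition theta ::
    "real \<Rightarrow> real \<Rightarrow> real \<Rightarrow> real \<Rightarrow> ('p::finite \<Rightarrow> real) \<Rightarrow> ('p \<Rightarrow> real) \<Rightarrow>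
     ('p \<Rightarrow> real^5) \<Rightarrow> real^3" where
  "theta Rg \<gamma> \<mu> h P J U =
     (\<chi> l. min (MAX a. theta_point Rg \<gamma> \<mu> h P J U a l) (MIN a. point_weight P J U a))"

definition limiter_matrix :: "real^3 \<Rightarrow> real^3 \<Rightarrow> real^3^5" where
  "limiter_matrix \<theta> W = vector
     [vector [0, 0, 0],
      vector [\<theta>$1, 0, 0],
      vector [0, \<theta>$2, 0],
      vector [0, 0, \<theta>$3],
      vector [\<theta>$1 * W$1, \<theta>$2 * W$2, \<theta>$3 * W$3]]"

definition limiter_step ::
    "real \<Rightarrow> real \<Rightarrow> real \<Rightarrow> real \<Rightarrow> ('p::finite \<Rightarrow> real) \<Rightarrow> ('p \<Rightarrow> real) \<Rightarrow>
     ('p \<Rightarrow> real^5) \<Rightarrow> 'p \<Rightarrow> real^5" where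
  "limiter_step Rg \<gamma> \<mu> h P J Uhat a =
     (let U = physical J Uhat;
          Vbar = avg (\<lambda>b. velocity (U b))
      in Uhat a + (1 / P a * rho_min U) *\<^sub>R
           (limiter_matrix (theta Rg \<gamma> \<mu> h P J U) Vbar *v (Vbar - velocity (U a))))"

text \<open>
  \<^const>\<open>mass_density\<close>, \<^const>\<open>velocity\<close> and \<^const>\<open>temperature\<close> invert \<^const>\<open>conserved\<close>.
\<close>

lemma vector_5:
  fixes v w x y z :: "'a::zero"
  shows "(vector [v, w, x, y, z] :: 'a^5) $ 1 = v"
    "(vector [v, w, x, y, z] :: 'a^5) $ 2 = w"
    "(vector [v, w, x, y, z] :: 'a^5) $ 3 = x"
    "(vector [v, w, x, y, z] :: 'a^5) $ 4 = y"
    "(vector [v, w, x, y, z] :: 'a^5) $ 5 = z"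
  by (simp_all add: vector_def)

lemma conserved_inverse:
  assumes "Rg > 0" "\<gamma> > 1" "\<rho> > 0"
  shows "mass_density (conserved Rg \<gamma> \<rho> V T) = \<rho>"
    and "velocity (conserved Rg \<gamma> \<rho> V T) = V"
    and "temperature Rg \<gamma> (conserved Rg \<gamma> \<rho> V T) = T"
proof -
  show d: "mass_density (conserved Rg \<gamma> \<rho> V T) = \<rho>"
    by (simp add: mass_density_def conserved_def Let_def vector_5)
  show v: "velocity (conserved Rg \<gamma> \<rho> V T) = V"
    unfolding velocity_def d vec_eq_iff forall_3
    using assms by (simp add: conserved_def Let_def vector_5)
  show "temperature Rg \<gamma> (conserved Rg \<gamma> \<rho> V T) = T"
    unfolding temperature_def total_energy_def d v
    using assms by (simp add: conserved_def Let_def vector_5)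
qed

end

theory Submission
  imports Defs
begin

text \<open>
  In primitive variables a step of the limiter keeps the density at every point and damps each
  velocity component towards its mean over the element by the factor \<open>1 - t / w a\<close>, where \<open>t\<close> is
  the limiter coefficient of the component and \<open>w a\<close> is the weight of the point.  As
  \<open>0 \<le> t \<le> w a\<close>, this factor lies in \<open>[0, 1]\<close>.  The energy is updated such that the damping adds
  heat at every point (\<open>limiter_step_primitive\<close>).  So no temperature decreases, and no mathematical
  entropy increases, because it is antitone in the temperature at fixed density.  Conservation
  holds because the deviations from a mean sum to zero.

  The weights depend on the densities only and are thus constant during the iteration.  The bound on
  the spread of a velocity component is therefore a statement on the damping of finitely many
  numbers (\<open>spread_damping\<close>).  It also yields convergence: the change of a velocity in one step is
  at most a constant times the loss of spread in that step, and these losses telescope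
  (\<open>iterated_damping_convergent\<close>).  The temperatures are nondecreasing and are bounded through the
  conserved total energy, hence converge as well, to positive limits.  Densities, velocities and temperatures
  together determine the conserved variables, so these converge.

  In the limit the velocity bound must hold.  Since the velocities converge, their increments vanish,
  so the coefficient times the deviation from the mean tends to zero at every point.  A violation
  that persisted in the limit would keep both factors away from zero
  (\<open>limit_satisfies_velocity_bound\<close>).
\<close>

section \<open>Damping a finite family of numbers towards its mean\<close>

lemma avg_component:
  fixes f :: "'p::finite \<Rightarrow> real^'n"
  shows "avg f $ l = avg (\<lambda>b. f b $ l)"
  by (simp add: avg_def)

lemma avg_pos:
  fixes f :: "'p::finite \<Rightarrow> real"
  assumes "\<And>a. f a > 0"
  shows "avg f > 0"
  using assms by (simp add: avg_def sum_pos)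

lemma sum_avg_minus:
  fixes f :: "'p::finite \<Rightarrow> 'v::real_vector"
  shows "(\<Sum>a\<in>UNIV. avg f - f a) = 0"
  by (simp add: sum_subtractf avg_def sum_constant_scaleR)

lemma tendsto_avg:
  fixes f :: "nat \<Rightarrow> 'p::finite \<Rightarrow> real"
  assumes "\<And>a. (\<lambda>m. f m a) \<longlonglongrightarrow> g a"
  shows "(\<lambda>m. avg (f m)) \<longlonglongrightarrow> avg g"
  unfolding avg_def by (intro tendsto_intros assms)

definition spread :: "('p::finite \<Rightarrow> real) \<Rightarrow> real" where
  "spread v = (MAX a. v a) - (MIN a. v a)"

lemma avg_le_Max:
  fixes v :: "'p::finite \<Rightarrow> real"
  shows "avg v \<le> (MAX a. v a)"
proof -
  have "(\<Sum>a\<in>UNIV. v a) \<le> of_nat CARD('p) * (MAX a. v a)"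
    by (rule sum_bounded_above) simp
  then show ?thesis by (simp add: avg_def field_simps)
qed

lemma Min_le_avg:
  fixes v :: "'p::finite \<Rightarrow> real"
  shows "(MIN a. v a) \<le> avg v"
proof -
  have "of_nat CARD('p) * (MIN a. v a) \<le> (\<Sum>a\<in>UNIV. v a)"
    by (rule sum_bounded_below) simp
  then show ?thesis by (simp add: avg_def field_simps)
qed

lemma abs_diff_avg_le_spread:
  fixes v :: "'p::finite \<Rightarrow> real"
  shows "\<bar>v a - avg v\<bar> \<le> spread v"
proof -
  have "v a \<le> (MAX a. v a)" "(MIN a. v a) \<le> v a" by simp_all
  then show ?thesis
    using avg_le_Max[of v] Min_le_avg[of v] unfolding spread_def by linarith
qed

lemma spread_nonneg: "spread v \<ge> 0"
  using abs_diff_avg_le_spread[of v undefined] by linarith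

text \<open>
  The mean lies between the extremes, so multiplying every deviation from it by a factor in
  \<open>[0, q]\<close> multiplies the distance of the mean to either extreme by at most \<open>q\<close>.  Here the factor
  at \<open>a\<close> is \<open>1 - t / w a\<close>, and the largest weight gives \<open>q\<close>.
\<close>

lemma spread_damping:
  fixes v v' w :: "'p::finite \<Rightarrow> real"
  assumes w: "\<And>a. w a > 0" and t: "0 \<le> t" "\<And>a. t \<le> w a"
    and v': "\<And>a. v' a = v a - t / w a * (v a - avg v)"
  shows "spread v' \<le> spread v * (1 - t / (MAX a. w a))"
proof -
  define q where "q = 1 - t / (MAX a. w a)"
  have factor: "0 \<le> 1 - t / w a" "1 - t / w a \<le> q" for a
  proof -
    show "0 \<le> 1 - t / w a" using w[of a] t(2)[of a] by simp
    have "t / (MAX a. w a) \<le> t / w a"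
      using w[of a] t(1) by (intro divide_left_mono mult_pos_pos) (auto intro: less_le_trans)
    then show "1 - t / w a \<le> q" by (simp add: q_def)
  qed
  have q: "0 \<le> q" using factor order_trans by blast
  have dev: "v' a = avg v + (1 - t / w a) * (v a - avg v)" for a
    by (simp add: v' algebra_simps)
  have hi: "v' a \<le> avg v + q * ((MAX a. v a) - avg v)" for a
  proof -
    have "(1 - t / w a) * (v a - avg v) \<le> (1 - t / w a) * ((MAX a. v a) - avg v)"
      using factor(1) by (intro mult_left_mono) simp_all
    also have "\<dots> \<le> q * ((MAX a. v a) - avg v)"
      using factor(2) avg_le_Max[of v] by (intro mult_right_mono) simp_all
    finally show ?thesis by (simp add: dev)
  qed
  have lo: "avg v - q * (avg v - (MIN a. v a)) \<le> v' a" for a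
  proof -
    have "(1 - t / w a) * (avg v - v a) \<le> (1 - t / w a) * (avg v - (MIN a. v a))"
      using factor(1) by (intro mult_left_mono) simp_all
    also have "\<dots> \<le> q * (avg v - (MIN a. v a))"
      using factor(2) Min_le_avg[of v] by (intro mult_right_mono) simp_all
    finally show ?thesis by (simp add: dev algebra_simps)
  qed
  have "(MAX a. v' a) \<le> avg v + q * ((MAX a. v a) - avg v)"
    using hi by simp
  moreover have "avg v - q * (avg v - (MIN a. v a)) \<le> (MIN a. v' a)"
    using lo by simp
  ultimately have "spread v' \<le> q * spread v"
    unfolding spread_def by (simp add: algebra_simps)
  then show ?thesis by (simp add: q_def mult.commute)
qed

lemma spread_iterated_damping:
  fixes v :: "nat \<Rightarrow> 'p::finite \<Rightarrow> real"
  assumes w: "\<And>a. w a > 0" and t: "\<And>m. 0 \<le> t (Suc m)" "\<And>m a. t (Suc m) \<le> w a"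
    and v: "\<And>m a. v (Suc m) a = v m a - t (Suc m) / w a * (v m a - avg (v m))"
  shows "spread (v m) \<le> spread (v 0) * (\<Prod>n=1..m. 1 - t n / (MAX a. w a))"
proof (induction m)
  case 0
  then show ?case by simp
next
  case (Suc m)
  have "w undefined \<le> (MAX a. w a)" by simp
  then have "t (Suc m) \<le> (MAX a. w a)" "0 < (MAX a. w a)"
    using t(2)[of m undefined] w[of undefined] by linarith+
  then have "0 \<le> 1 - t (Suc m) / (MAX a. w a)" by simp
  with Suc have "spread (v m) * (1 - t (Suc m) / (MAX a. w a))
      \<le> spread (v 0) * (\<Prod>n=1..m. 1 - t n / (MAX a. w a)) * (1 - t (Suc m) / (MAX a. w a))"
    by (rule mult_right_mono)
  with spread_damping[OF w t v] show ?case
    by (simp add: mult.assoc) (rule order_trans)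
qed

text \<open>
  An increment at one point is at most \<open>t / w a\<close> times the spread, while the spread loses at least
  \<open>t / (MAX a. w a)\<close> times itself in the same step.  Hence the increments are dominated by the
  telescoping losses of the spread and are absolutely summable.
\<close>

lemma iterated_damping_convergent:
  fixes v :: "nat \<Rightarrow> 'p::finite \<Rightarrow> real"
  assumes w: "\<And>a. w a > 0" and t: "\<And>m. 0 \<le> t (Suc m)" "\<And>m a. t (Suc m) \<le> w a"
    and v: "\<And>m a. v (Suc m) a = v m a - t (Suc m) / w a * (v m a - avg (v m))"
  shows "convergent (\<lambda>m. v m a)"
proof -
  define W where "W = (MAX a. w a)"
  have "w a \<le> W" by (simp add: W_def)
  with w[of a] have W: "W > 0" by linarith
  define D where "D m = spread (v m)" for m
  have loss: "D m * t (Suc m) / W \<le> D m - D (Suc m)" for m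
    using spread_damping[OF w t v, of m] by (simp add: D_def W_def algebra_simps)
  have "D m * t (Suc m) / W \<ge> 0" for m
    unfolding D_def using W t(1)
    by (intro divide_nonneg_pos mult_nonneg_nonneg spread_nonneg)
  with loss have "decseq D" by (intro decseq_SucI) (smt (verit))
  then obtain L where "D \<longlonglongrightarrow> L"
    by (rule decseq_convergent[where B = 0]) (simp_all add: D_def spread_nonneg)
  then have "summable (\<lambda>m. W / w a * (D m - D (Suc m)))"
    by (intro summable_mult telescope_summable')
  moreover have "norm (v (Suc m) a - v m a) \<le> W / w a * (D m - D (Suc m))" for m
  proof -
    have "norm (v (Suc m) a - v m a) = t (Suc m) / w a * \<bar>v m a - avg (v m)\<bar>"
      using t(1)[of m] w[of a] by (simp add: v abs_mult)
    also have "\<dots> \<le> t (Suc m) / w a * D m"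
      using t(1)[of m] w[of a] by (intro mult_left_mono) (auto simp: D_def abs_diff_avg_le_spread)
    also have "\<dots> = W / w a * (D m * t (Suc m) / W)" using W by simp
    also have "\<dots> \<le> W / w a * (D m - D (Suc m))"
      using W w[of a] by (intro mult_left_mono loss) simp
    finally show ?thesis .
  qed
  ultimately have "summable (\<lambda>m. v (Suc m) a - v m a)"
    by (rule summable_comparison_test'[where N = 0])
  then have "convergent (\<lambda>n. \<Sum>m<n. v (Suc m) a - v m a)"
    by (simp add: summable_iff_convergent)
  then have "convergent (\<lambda>n. v n a - v 0 a)"
    unfolding sum_lessThan_telescope[of "\<lambda>n. v n a"] .
  then have "convergent (\<lambda>n. (v n a - v 0 a) + v 0 a)" by (intro convergent_add convergent_const)
  then show ?thesis by simp
qed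

section \<open>Gas states in primitive variables\<close>

lemma exhaust_5:
  fixes x :: 5
  shows "x = 1 \<or> x = 2 \<or> x = 3 \<or> x = 4 \<or> x = 5"
proof (induct x)
  case (of_int z)
  then have "z = 0 \<or> z = 1 \<or> z = 2 \<or> z = 3 \<or> z = 4" by simp arith
  then show ?case by auto
qed

lemma forall_5: "(\<forall>i::5. P i) \<longleftrightarrow> P 1 \<and> P 2 \<and> P 3 \<and> P 4 \<and> P 5"
  by (metis exhaust_5)

lemma norm_sq_3: "(norm (x::real^3))\<^sup>2 = (x$1)\<^sup>2 + (x$2)\<^sup>2 + (x$3)\<^sup>2"
  unfolding power2_norm_eq_inner by (simp add: inner_vec_def sum_3 power2_eq_square)

lemma velocity_nth:
  "velocity U $ 1 = U$2 / U$1" "velocity U $ 2 = U$3 / U$1" "velocity U $ 3 = U$4 / U$1"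
  by (simp_all add: velocity_def mass_density_def)

lemma conserved_of_primitive:
  assumes "Rg > 0" "\<gamma> > 1" "mass_density U > 0"
  shows "conserved Rg \<gamma> (mass_density U) (velocity U) (temperature Rg \<gamma> U) = U"
proof -
  have "U$1 > 0" using assms by (simp add: mass_density_def)
  moreover have "Rg * temperature Rg \<gamma> U / (\<gamma> - 1) + (norm (velocity U))\<^sup>2 / 2 = U$5 / U$1"
    using assms by (simp add: temperature_def total_energy_def mass_density_def)
  ultimately show ?thesis
    by (simp add: vec_eq_iff forall_5 conserved_def Let_def vector_5 velocity_nth
        mass_density_def)
qed

lemma tendsto_conserved:
  assumes "\<And>l. (\<lambda>m. V m $ l) \<longlonglongrightarrow> V' $ l" "T \<longlonglongrightarrow> T'"
  shows "(\<lambda>m. conserved Rg \<gamma> \<rho> (V m) (T m)) \<longlonglongrightarrow> conserved Rg \<gamma> \<rho> V' T'"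
proof (rule vec_tendstoI)
  fix i :: 5
  have V: "V \<longlonglongrightarrow> V'" using assms(1) by (rule vec_tendstoI)
  have "\<forall>i. (\<lambda>m. conserved Rg \<gamma> \<rho> (V m) (T m) $ i) \<longlonglongrightarrow> conserved Rg \<gamma> \<rho> V' T' $ i"
    unfolding forall_5 conserved_def Let_def vector_5 divide_inverse
    by (intro conjI tendsto_intros assms V)
  then show "(\<lambda>m. conserved Rg \<gamma> \<rho> (V m) (T m) $ i) \<longlonglongrightarrow> conserved Rg \<gamma> \<rho> V' T' $ i" ..
qed

lemma math_entropy_antimono_temperature:
  assumes "Rg > 0" "\<gamma> > 1" "mass_density U > 0" "temperature Rg \<gamma> U > 0"
    and "mass_density U' = mass_density U" "temperature Rg \<gamma> U \<le> temperature Rg \<gamma> U'"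
  shows "math_entropy Rg \<gamma> s0 U' \<le> math_entropy Rg \<gamma> s0 U"
proof -
  have "ln (temperature Rg \<gamma> U) \<le> ln (temperature Rg \<gamma> U')"
    using assms by simp
  then have "Rg / (\<gamma> - 1) * ln (temperature Rg \<gamma> U) \<le> Rg / (\<gamma> - 1) * ln (temperature Rg \<gamma> U')"
    using assms by (intro mult_left_mono) simp_all
  then show ?thesis
    using assms by (simp add: math_entropy_def thermo_entropy_def)
qed

section \<open>One step of the limiter\<close>

definition admissible :: "real \<Rightarrow> real \<Rightarrow> ('p \<Rightarrow> real^5) \<Rightarrow> bool" where
  "admissible Rg \<gamma> U \<longleftrightarrow> (\<forall>a. mass_density (U a) > 0 \<and> temperature Rg \<gamma> (U a) > 0)"

lemma harmonic_mean_pos: "x > 0 \<Longrightarrow> y > 0 \<Longrightarrow> harmonic_mean x y > 0"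
  by (simp add: harmonic_mean_def add_pos_pos)

lemma tendsto_harmonic_mean:
  assumes "f \<longlonglongrightarrow> x" "g \<longlonglongrightarrow> y" "x > 0" "y > 0"
  shows "(\<lambda>m. harmonic_mean (f m) (g m)) \<longlonglongrightarrow> harmonic_mean x y"
proof -
  have "1 / x + 1 / y \<noteq> 0" using assms by (smt (verit) divide_pos_pos)
  with assms show ?thesis
    unfolding harmonic_mean_def by (intro tendsto_intros) auto
qed

lemma velocity_bound_pos:
  assumes "admissible Rg \<gamma> U" "\<mu> > 0" "h > 0"
  shows "velocity_bound Rg \<gamma> \<mu> h U a > 0"
  using assms unfolding velocity_bound_def admissible_def
  by (intro divide_pos_pos mult_pos_pos harmonic_mean_pos avg_pos) auto

lemma rho_min_pos: "(\<And>a. mass_density (U a) > 0) \<Longrightarrow> rho_min U > 0"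
  by (simp add: rho_min_def)

lemma point_weight_pos:
  assumes "\<And>a. P a > 0" "\<And>a. J a > 0" "\<And>a. mass_density (U a) > 0"
  shows "point_weight P J U a > 0"
  using assms rho_min_pos[of U] by (simp add: point_weight_def)

lemma theta_le_point_weight: "theta Rg \<gamma> \<mu> h P J U $ l \<le> point_weight P J U a"
  by (simp add: theta_def min.coboundedI2)

lemma theta_nonneg:
  assumes "\<And>a. P a > 0" "\<And>a. J a > 0" "admissible Rg \<gamma> U" "\<mu> > 0" "h > 0"
  shows "theta Rg \<gamma> \<mu> h P J U $ l \<ge> 0"
proof -
  have w: "point_weight P J U a > 0" for a
    using assms by (intro point_weight_pos) (auto simp: admissible_def)
  have "0 \<le> theta_point Rg \<gamma> \<mu> h P J U undefined l"
    using velocity_bound_pos[OF assms(3-5), of undefined] w[of undefined]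
    by (auto simp: theta_point_def)
  also have "\<dots> \<le> (MAX a. theta_point Rg \<gamma> \<mu> h P J U a l)" by simp
  finally show ?thesis
    using w by (simp add: theta_def less_imp_le)
qed

lemma limiter_matrix_mult:
  "(limiter_matrix t W *v d) $ 1 = 0"
  "(limiter_matrix t W *v d) $ 2 = t$1 * d$1"
  "(limiter_matrix t W *v d) $ 3 = t$2 * d$2"
  "(limiter_matrix t W *v d) $ 4 = t$3 * d$3"
  "(limiter_matrix t W *v d) $ 5 = t$1 * W$1 * d$1 + t$2 * W$2 * d$2 + t$3 * W$3 * d$3"
  by (simp_all add: limiter_matrix_def matrix_vector_mult_def vector_5 sum_3)

text \<open>The prefactor \<open>1 / P a\<close> cancels the quadrature weight, and deviations from a mean sum to zero.\<close>

lemma limiter_step_conservative: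
  fixes Uhat :: "'p::finite \<Rightarrow> real^5"
  assumes "\<And>a. P a > 0"
  shows "(\<Sum>a\<in>UNIV. P a *\<^sub>R limiter_step Rg \<gamma> \<mu> h P J Uhat a) = (\<Sum>a\<in>UNIV. P a *\<^sub>R Uhat a)"
proof -
  define U where "U = physical J Uhat"
  define Vbar where "Vbar = avg (\<lambda>b. velocity (U b))"
  define M where "M = limiter_matrix (theta Rg \<gamma> \<mu> h P J U) Vbar"
  have "P a *\<^sub>R limiter_step Rg \<gamma> \<mu> h P J Uhat a
      = P a *\<^sub>R Uhat a + rho_min U *\<^sub>R (M *v (Vbar - velocity (U a)))" for a
    using assms[of a]
    by (simp add: limiter_step_def Let_def U_def Vbar_def M_def scaleR_add_right)
  then have "(\<Sum>a\<in>UNIV. P a *\<^sub>R limiter_step Rg \<gamma> \<mu> h P J Uhat a)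
      = (\<Sum>a\<in>UNIV. P a *\<^sub>R Uhat a) + rho_min U *\<^sub>R (\<Sum>a\<in>UNIV. M *v (Vbar - velocity (U a)))"
    by (simp add: sum.distrib scaleR_sum_right)
  also have "(\<Sum>a\<in>UNIV. M *v (Vbar - velocity (U a))) = M *v (\<Sum>a\<in>UNIV. Vbar - velocity (U a))"
    by (simp add: linear_sum)
  also have "\<dots> = 0"
    by (simp add: Vbar_def sum_avg_minus)
  finally show ?thesis by simp
qed

text \<open>
  In primitive variables the step decouples: every velocity component is damped towards its own
  mean with factor \<open>1 - r l\<close>.  The energy row is chosen such that the step adds
  \<open>r l * Vbar l * d\<close> to the specific total energy, where \<open>d = Vbar l - V l\<close>; the kinetic energy
  changes by \<open>r l * V l * d + (r l * d)\<^sup>2 / 2\<close>, and the difference \<open>r l * (1 - r l / 2) * d\<^sup>2\<close> is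
  left as heat.
\<close>

lemma limiter_step_primitive:
  fixes Uhat :: "'p::finite \<Rightarrow> real^5" and P J :: "'p \<Rightarrow> real" and Rg \<gamma> \<mu> h :: real
  defines "U \<equiv> physical J Uhat"
  defines "U' \<equiv> physical J (limiter_step Rg \<gamma> \<mu> h P J Uhat)"
  defines "r \<equiv> \<lambda>a l. theta Rg \<gamma> \<mu> h P J U $ l / point_weight P J U a"
  assumes P: "\<And>a. P a > 0" and J: "\<And>a. J a > 0" and \<rho>: "\<And>a. mass_density (U a) > 0"
  shows "mass_density (U' a) = mass_density (U a)"
    and "velocity (U' a) $ l = velocity (U a) $ l
           - r a l * (velocity (U a) $ l - avg (\<lambda>b. velocity (U b) $ l))"
    and "temperature Rg \<gamma> (U' a) = temperature Rg \<gamma> (U a) + (\<gamma> - 1) / Rg *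
           (\<Sum>l\<in>UNIV. r a l * (1 - r a l / 2) *
              (velocity (U a) $ l - avg (\<lambda>b. velocity (U b) $ l))\<^sup>2)"
proof -
  define t where "t = theta Rg \<gamma> \<mu> h P J U"
  define Vbar where "Vbar = avg (\<lambda>b. velocity (U b))"
  define d where "d = Vbar - velocity (U a)"
  define \<kappa> where "\<kappa> = U a $ 1 / point_weight P J U a"
  have \<rho>a: "U a $ 1 > 0" using \<rho>[of a] by (simp add: mass_density_def)
  have w: "point_weight P J U a > 0" using P J \<rho> by (rule point_weight_pos)
  have r: "\<kappa> * t $ l = U a $ 1 * r a l" for l
    by (simp add: \<kappa>_def r_def t_def)
  have "\<kappa> = inverse (J a) * (1 / P a * rho_min U)"
    using \<rho>a rho_min_pos[OF \<rho>] J[of a] P[of a]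
    by (simp add: \<kappa>_def point_weight_def mass_density_def field_simps less_imp_neq[symmetric])
  then have U': "U' a = U a + \<kappa> *\<^sub>R (limiter_matrix t Vbar *v d)"
    by (simp add: U'_def physical_def limiter_step_def Let_def U_def t_def Vbar_def d_def
        scaleR_add_right)
  have U1: "U' a $ 1 = U a $ 1"
    by (simp add: U' limiter_matrix_mult)
  have V: "velocity (U' a) $ l = velocity (U a) $ l + r a l * d $ l" for l
  proof -
    have "\<forall>l. velocity (U' a) $ l = velocity (U a) $ l + r a l * d $ l"
      unfolding forall_3 velocity_nth U1
      using \<rho>a by (simp add: U' limiter_matrix_mult add_divide_distrib r flip: mult.assoc)
    then show ?thesis by blast
  qed
  have d: "d $ l = - (velocity (U a) $ l - avg (\<lambda>b. velocity (U b) $ l))" for l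
    by (simp add: d_def Vbar_def avg_component)
  show "mass_density (U' a) = mass_density (U a)"
    using U1 by (simp add: mass_density_def)
  show "velocity (U' a) $ l = velocity (U a) $ l
           - r a l * (velocity (U a) $ l - avg (\<lambda>b. velocity (U b) $ l))"
    unfolding V d by (simp add: algebra_simps)
  have "U' a $ 5 = U a $ 5 + U a $ 1 * (\<Sum>l\<in>UNIV. r a l * Vbar $ l * d $ l)"
    by (simp add: U' limiter_matrix_mult sum_3 distrib_left r flip: mult.assoc)
  then have E: "total_energy (U' a) = total_energy (U a) + (\<Sum>l\<in>UNIV. r a l * Vbar $ l * d $ l)"
    using \<rho>a by (simp add: total_energy_def mass_density_def U1 field_simps)
  have Vb: "Vbar $ l = velocity (U a) $ l + d $ l" for l by (simp add: d_def)
  have heat: "(\<Sum>l\<in>UNIV. r a l * Vbar $ l * d $ l) - (norm (velocity (U' a)))\<^sup>2 / 2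
      + (norm (velocity (U a)))\<^sup>2 / 2 = (\<Sum>l\<in>UNIV. r a l * (1 - r a l / 2) * (d $ l)\<^sup>2)"
    unfolding norm_sq_3 sum_3 V Vb by (simp add: field_simps power2_eq_square)
  have "temperature Rg \<gamma> (U' a) = temperature Rg \<gamma> (U a)
      + (\<gamma> - 1) / Rg * (\<Sum>l\<in>UNIV. r a l * (1 - r a l / 2) * (d $ l)\<^sup>2)"
    unfolding temperature_def E heat[symmetric] by (simp add: algebra_simps)
  then show "temperature Rg \<gamma> (U' a) = temperature Rg \<gamma> (U a) + (\<gamma> - 1) / Rg *
           (\<Sum>l\<in>UNIV. r a l * (1 - r a l / 2) *
              (velocity (U a) $ l - avg (\<lambda>b. velocity (U b) $ l))\<^sup>2)"
    unfolding d power2_minus .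
qed

lemma limiter_step_temperature_mono:
  fixes Uhat :: "'p::finite \<Rightarrow> real^5"
  assumes "Rg > 0" "\<gamma> > 1" "\<mu> > 0" "h > 0" "\<And>a. P a > 0" "\<And>a. J a > 0"
    and adm: "admissible Rg \<gamma> (physical J Uhat)"
  shows "temperature Rg \<gamma> (physical J Uhat a)
    \<le> temperature Rg \<gamma> (physical J (limiter_step Rg \<gamma> \<mu> h P J Uhat) a)"
proof -
  define r where
    "r l = theta Rg \<gamma> \<mu> h P J (physical J Uhat) $ l / point_weight P J (physical J Uhat) a" for l
  have \<rho>: "mass_density (physical J Uhat b) > 0" for b using adm by (simp add: admissible_def)
  have w: "point_weight P J (physical J Uhat) a > 0"
    using assms \<rho> by (intro point_weight_pos) auto
  have "0 \<le> r l" "r l \<le> 1" for l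
    using theta_nonneg[OF assms(5,6) adm assms(3,4)] theta_le_point_weight w
    by (simp_all add: r_def)
  then have "0 \<le> (\<Sum>l\<in>UNIV. r l * (1 - r l / 2) * (x l)\<^sup>2)" for x
    by (intro sum_nonneg mult_nonneg_nonneg) (auto simp: field_simps intro: order_trans[of _ 1 2])
  then show ?thesis
    unfolding limiter_step_primitive(3)[where P = P and J = J and Uhat = Uhat, OF assms(5,6) \<rho>] r_def[symmetric]
    using assms(1,2) by simp
qed

section \<open>Limits of the iteration\<close>

lemma tendsto_velocity_bound:
  fixes U :: "nat \<Rightarrow> 'p::finite \<Rightarrow> real^5"
  assumes "\<And>b. (\<lambda>m. mass_density (U m b)) \<longlonglongrightarrow> mass_density (L b)"
    and "\<And>b. (\<lambda>m. temperature Rg \<gamma> (U m b)) \<longlonglongrightarrow> temperature Rg \<gamma> (L b)"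
    and "admissible Rg \<gamma> L"
  shows "(\<lambda>m. velocity_bound Rg \<gamma> \<mu> h (U m) a) \<longlonglongrightarrow> velocity_bound Rg \<gamma> \<mu> h L a"
  unfolding velocity_bound_def divide_inverse
  using assms
  by (intro tendsto_mult tendsto_const tendsto_harmonic_mean tendsto_avg avg_pos)
     (auto simp: admissible_def)

text \<open>
  If a limit state violated the bound at some point, the pointwise coefficient there would converge
  to a positive number.  The coefficient of the limiter, being at least the minimum of this
  coefficient and a positive weight, would keep damping by a fixed amount, so its product with the
  deviation could not vanish.
\<close>

lemma limit_satisfies_velocity_bound:
  fixes U :: "nat \<Rightarrow> 'p::finite \<Rightarrow> real^5"
  assumes P: "\<And>a. P a > 0" and J: "\<And>a. J a > 0" and "\<mu> > 0" "h > 0"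
    and \<rho>: "\<And>m b. mass_density (U m b) = mass_density (L b)"
    and V: "\<And>b. (\<lambda>m. velocity (U m b) $ l) \<longlonglongrightarrow> velocity (L b) $ l"
    and T: "\<And>b. (\<lambda>m. temperature Rg \<gamma> (U m b)) \<longlonglongrightarrow> temperature Rg \<gamma> (L b)"
    and adm: "admissible Rg \<gamma> L"
    and stall: "(\<lambda>m. theta Rg \<gamma> \<mu> h P J (U m) $ l * velocity_deviation (U m) a l) \<longlonglongrightarrow> 0"
  shows "velocity_deviation L a l \<le> velocity_bound Rg \<gamma> \<mu> h L a"
proof (rule ccontr)
  assume violated: "\<not> ?thesis"
  define B where "B = (\<lambda>m. velocity_bound Rg \<gamma> \<mu> h (U m) a)"
  define D where "D = (\<lambda>m. velocity_deviation (U m) a l)"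
  define B' where "B' = velocity_bound Rg \<gamma> \<mu> h L a"
  define D' where "D' = velocity_deviation L a l"
  define w where "w = point_weight P J L a"
  define W where "W = (MIN a. point_weight P J L a)"
  have w_pos: "point_weight P J L b > 0" for b
    using P J adm by (intro point_weight_pos) (auto simp: admissible_def)
  have weight: "point_weight P J (U m) = point_weight P J L" for m
    by (simp add: fun_eq_iff point_weight_def rho_min_def \<rho>)
  have gap: "B' < D'" using violated by (simp add: B'_def D'_def)
  have "B' > 0" unfolding B'_def using adm assms(3,4) by (rule velocity_bound_pos)
  have B: "B \<longlonglongrightarrow> B'"
    unfolding B_def B'_def using T adm by (intro tendsto_velocity_bound) (simp_all add: \<rho>)
  have D: "D \<longlonglongrightarrow> D'"
    unfolding D_def D'_def velocity_deviation_def
    by (intro tendsto_rabs tendsto_diff V tendsto_avg)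
  have "(\<lambda>m. min (w * (1 - B m / D m)) W * D m) \<longlonglongrightarrow> min (w * (1 - B' / D')) W * D'"
    using gap \<open>B' > 0\<close> by (intro tendsto_intros B D) simp
  moreover have "eventually (\<lambda>m. min (w * (1 - B m / D m)) W * D m
      \<le> theta Rg \<gamma> \<mu> h P J (U m) $ l * velocity_deviation (U m) a l) sequentially"
  proof -
    have "eventually (\<lambda>m. D m - B m > 0) sequentially"
      using gap by (intro order_tendstoD(1)[OF tendsto_diff[OF D B]]) simp
    then show ?thesis
    proof eventually_elim
      case (elim m)
      have "w * (1 - B m / D m) = theta_point Rg \<gamma> \<mu> h P J (U m) a l"
        using elim by (simp add: theta_point_def B_def D_def weight w_def)
      also have "\<dots> \<le> (MAX a. theta_point Rg \<gamma> \<mu> h P J (U m) a l)" by simp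
      finally have "min (w * (1 - B m / D m)) W \<le> theta Rg \<gamma> \<mu> h P J (U m) $ l"
        by (simp add: theta_def weight W_def min.coboundedI1)
      then show ?case
        by (auto simp: D_def velocity_deviation_def intro: mult_right_mono)
    qed
  qed
  ultimately have "min (w * (1 - B' / D')) W * D' \<le> 0"
    using stall by (intro tendsto_le[OF sequentially_bot]) auto
  moreover have "w * (1 - B' / D') > 0" "W > 0" "D' > 0"
    using gap \<open>B' > 0\<close> w_pos by (auto simp: w_def W_def)
  ultimately show False by (smt (verit) mult_pos_pos)
qed

section \<open>Conservation, dissipation and convergence of the iterated limiter\<close>

theorem theorem9:
  fixes Rg \<gamma> \<mu> h s0 :: real
    and P J :: "'p::finite \<Rightarrow> real"
    and Uhat U :: "nat \<Rightarrow> 'p \<Rightarrow> real^5"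
    and \<theta> :: "nat \<Rightarrow> real^3"
  assumes "Rg > 0" and "\<gamma> > 1" and "\<mu> > 0" and "h > 0"
    and "\<And>a. P a > 0" and "\<And>a. J a > 0"
    and U: "\<And>m. U m = physical J (Uhat m)"
    and init_density: "\<And>a. mass_density (U 0 a) > 0"
    and init_temperature: "\<And>a. temperature Rg \<gamma> (U 0 a) > 0"
    and theta: "\<And>m. \<theta> (Suc m) = theta Rg \<gamma> \<mu> h P J (U m)"
    and step: "\<And>m. Uhat (Suc m) = limiter_step Rg \<gamma> \<mu> h P J (Uhat m)"
  shows
    "(\<forall>m. (\<Sum>a\<in>UNIV. P a *\<^sub>R Uhat (Suc m) a) = (\<Sum>a\<in>UNIV. P a *\<^sub>R Uhat m a)) \<and>
     (\<forall>m a. math_entropy Rg \<gamma> s0 (U (Suc m) a) \<le> math_entropy Rg \<gamma> s0 (U m a)) \<and>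
     (\<forall>l. \<forall>m\<ge>1.
        (MAX a. velocity (U m a) $ l) - (MIN a. velocity (U m a) $ l)
        \<le> ((MAX a. velocity (U 0 a) $ l) - (MIN a. velocity (U 0 a) $ l)) *
           (\<Prod>n=1..m. 1 - \<theta> n $ l / (MAX a. point_weight P J (U 0) a))) \<and>
     (\<exists>Uhat_lim. (\<forall>a. (\<lambda>m. Uhat m a) \<longlonglongrightarrow> Uhat_lim a) \<and>
        (\<forall>a l. velocity_deviation (physical J Uhat_lim) a l
               \<le> velocity_bound Rg \<gamma> \<mu> h (physical J Uhat_lim) a))"
proof -
  have U_Suc: "U (Suc m) = physical J (limiter_step Rg \<gamma> \<mu> h P J (Uhat m))" for m
    by (simp add: U step)
  have \<rho>_step: "mass_density (U (Suc m) a) = mass_density (U m a)"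
    and V_step: "velocity (U (Suc m) a) $ l = velocity (U m a) $ l
      - \<theta> (Suc m) $ l / point_weight P J (U m) a
          * (velocity (U m a) $ l - avg (\<lambda>b. velocity (U m b) $ l))"
    if "\<And>a. mass_density (U m a) > 0" for m a l
    using limiter_step_primitive(1,2)[where P = P and J = J and Uhat = "Uhat m", OF assms(5,6)] that
    by (simp_all add: U_Suc theta flip: U)
  have T_step: "temperature Rg \<gamma> (U m a) \<le> temperature Rg \<gamma> (U (Suc m) a)"
    if "admissible Rg \<gamma> (U m)" for m a
    using limiter_step_temperature_mono[where P = P and J = J and Uhat = "Uhat m", OF assms(1-6)] that
    by (simp add: U_Suc flip: U)
  have adm_\<rho>: "admissible Rg \<gamma> (U m) \<and> (\<forall>a. mass_density (U m a) = mass_density (U 0 a))" for m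
  proof (induction m)
    case 0
    then show ?case using init_density init_temperature by (simp add: admissible_def)
  next
    case (Suc m)
    then have "mass_density (U m a) > 0" for a by (auto simp only: admissible_def)
    then have "mass_density (U (Suc m) a) = mass_density (U m a)" for a by (rule \<rho>_step)
    moreover have "temperature Rg \<gamma> (U (Suc m) a) > 0" for a
    proof -
      have "0 < temperature Rg \<gamma> (U m a)" using Suc by (auto simp only: admissible_def)
      also have "\<dots> \<le> temperature Rg \<gamma> (U (Suc m) a)" using Suc by (intro T_step) simp
      finally show ?thesis .
    qed
    ultimately show ?case using Suc init_density by (simp add: admissible_def)
  qed
  then have adm: "admissible Rg \<gamma> (U m)" and \<rho>: "mass_density (U m a) = mass_density (U 0 a)"
    for m a by simp_all
  have \<rho>_pos: "mass_density (U m a) > 0" for m a using adm by (simp add: admissible_def)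
  define w where "w = point_weight P J (U 0)"
  have weight: "point_weight P J (U m) = w" for m
    by (simp add: fun_eq_iff w_def point_weight_def rho_min_def \<rho>[of m])
  have w: "w a > 0" for a
    unfolding w_def by (rule point_weight_pos[OF assms(5,6) init_density])
  have \<theta>: "0 \<le> \<theta> (Suc m) $ l" "\<theta> (Suc m) $ l \<le> w a" for m l a
    using theta_nonneg[OF assms(5,6) adm assms(3,4)] theta_le_point_weight
    by (simp_all add: theta flip: weight[of m])
  have V: "velocity (U (Suc m) a) $ l = velocity (U m a) $ l
      - \<theta> (Suc m) $ l / w a * (velocity (U m a) $ l - avg (\<lambda>b. velocity (U m b) $ l))" for m a l
    using V_step[OF \<rho>_pos] by (simp add: weight)

  have conservative: "(\<Sum>a\<in>UNIV. P a *\<^sub>R Uhat (Suc m) a) = (\<Sum>a\<in>UNIV. P a *\<^sub>R Uhat m a)" for m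
    unfolding step using assms(5) by (rule limiter_step_conservative)
  have dissipative: "math_entropy Rg \<gamma> s0 (U (Suc m) a) \<le> math_entropy Rg \<gamma> s0 (U m a)" for m a
    using assms(1,2) adm T_step[OF adm] \<rho>_step[OF \<rho>_pos]
    by (intro math_entropy_antimono_temperature) (auto simp: admissible_def)
  have contraction: "(MAX a. velocity (U m a) $ l) - (MIN a. velocity (U m a) $ l)
        \<le> ((MAX a. velocity (U 0 a) $ l) - (MIN a. velocity (U 0 a) $ l)) *
           (\<Prod>n=1..m. 1 - \<theta> n $ l / (MAX a. point_weight P J (U 0) a))" for l m
    using spread_iterated_damping[of w "\<lambda>m. \<theta> m $ l" "\<lambda>m a. velocity (U m a) $ l" m, OF w \<theta> V]
    by (simp add: spread_def w_def)

  have "\<exists>x. (\<lambda>m. velocity (U m a) $ l) \<longlonglongrightarrow> x" for a l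
    using iterated_damping_convergent[of w "\<lambda>m. \<theta> m $ l" "\<lambda>m a. velocity (U m a) $ l" a, OF w \<theta> V]
    by (simp add: convergent_def)
  then obtain V' where "\<And>a l. (\<lambda>m. velocity (U m a) $ l) \<longlonglongrightarrow> V' a l" by metis
  then have V_lim: "(\<lambda>m. velocity (U m a) $ l) \<longlonglongrightarrow> (\<chi> l. V' a l) $ l" for a l by simp

  \<comment> \<open>The temperatures are nondecreasing; they stay bounded because the total energy is conserved and
    no point has a negative energy.\<close>
  have U5: "P a * Uhat m a $ 5
      = P a * J a * mass_density (U 0 a) * (Rg * temperature Rg \<gamma> (U m a) / (\<gamma> - 1)
          + (norm (velocity (U m a)))\<^sup>2 / 2)" for m a
  proof -
    have "Uhat m a = J a *\<^sub>R conserved Rg \<gamma> (mass_density (U m a)) (velocity (U m a))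
        (temperature Rg \<gamma> (U m a))"
      using assms(6)[of a] conserved_of_primitive[OF assms(1,2) \<rho>_pos] by (simp add: U physical_def)
    then show ?thesis by (simp add: conserved_def Let_def vector_5 \<rho>[of m])
  qed
  define C where "C = (\<Sum>a\<in>UNIV. P a * Uhat 0 a $ 5)"
  have energy: "(\<Sum>a\<in>UNIV. P a * Uhat m a $ 5) = C" for m
  proof (induction m)
    case (Suc m)
    then show ?case using arg_cong[OF conservative[of m], of "\<lambda>x. x $ 5"] by simp
  qed (simp add: C_def)
  have T_bounded: "temperature Rg \<gamma> (U m a)
      \<le> C * (\<gamma> - 1) / (P a * J a * mass_density (U 0 a) * Rg)" for m a
  proof -
    have pos: "P a * J a * mass_density (U 0 a) > 0" for a
      using assms(5,6) init_density by simp
    have T_pos: "temperature Rg \<gamma> (U m b) > 0" for b using adm by (simp add: admissible_def)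
    have "P a * J a * mass_density (U 0 a) * (Rg * temperature Rg \<gamma> (U m a) / (\<gamma> - 1))
        \<le> P a * Uhat m a $ 5"
      unfolding U5 using pos[of a] by (intro mult_left_mono) simp_all
    also have "\<dots> \<le> (\<Sum>a\<in>UNIV. P a * Uhat m a $ 5)"
    proof (rule member_le_sum)
      fix b assume "b \<in> UNIV - {a}"
      show "0 \<le> P b * Uhat m b $ 5"
        unfolding U5 using pos[of b] T_pos[of b] assms(1,2)
        by (intro mult_nonneg_nonneg[OF less_imp_le] add_nonneg_nonneg) simp_all
    qed simp_all
    finally show ?thesis
      unfolding energy using pos[of a] assms(1,2) by (simp add: field_simps)
  qed
  have "\<exists>x. (\<lambda>m. temperature Rg \<gamma> (U m a)) \<longlonglongrightarrow> x" for a
    using incseq_convergent[OF incseq_SucI[of "\<lambda>m. temperature Rg \<gamma> (U m a)", OF T_step[OF adm]]]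
      T_bounded by (metis (no_types, lifting))
  then obtain T' where T_lim: "\<And>a. (\<lambda>m. temperature Rg \<gamma> (U m a)) \<longlonglongrightarrow> T' a" by metis
  have T'_pos: "T' a > 0" for a
  proof -
    have "incseq (\<lambda>m. temperature Rg \<gamma> (U m a))" using T_step[OF adm] by (rule incseq_SucI)
    then have "temperature Rg \<gamma> (U 0 a) \<le> T' a" using T_lim by (rule incseq_le)
    then show ?thesis using init_temperature[of a] by simp
  qed

  define L where "L a = conserved Rg \<gamma> (mass_density (U 0 a)) (\<chi> l. V' a l) (T' a)" for a
  have L_inverse: "mass_density (L a) = mass_density (U 0 a)" "velocity (L a) = (\<chi> l. V' a l)"
    "temperature Rg \<gamma> (L a) = T' a" for a
    unfolding L_def by (rule conserved_inverse[OF assms(1,2) init_density])+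
  define Uhat_lim where "Uhat_lim a = J a *\<^sub>R L a" for a
  have phys: "physical J Uhat_lim = L"
    using assms(6) by (simp add: fun_eq_iff physical_def Uhat_lim_def less_imp_neq[symmetric])
  have "(\<lambda>m. Uhat m a) \<longlonglongrightarrow> Uhat_lim a" for a
  proof -
    have "(\<lambda>m. conserved Rg \<gamma> (mass_density (U 0 a)) (velocity (U m a)) (temperature Rg \<gamma> (U m a)))
        \<longlonglongrightarrow> L a"
      unfolding L_def by (rule tendsto_conserved[OF V_lim T_lim])
    moreover have "conserved Rg \<gamma> (mass_density (U 0 a)) (velocity (U m a))
        (temperature Rg \<gamma> (U m a)) = U m a" for m
      using conserved_of_primitive[OF assms(1,2) \<rho>_pos, of m a] by (simp add: \<rho>[of m])
    ultimately have "(\<lambda>m. J a *\<^sub>R U m a) \<longlonglongrightarrow> Uhat_lim a"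
      unfolding Uhat_lim_def by (auto intro: tendsto_scaleR)
    then show ?thesis
      using assms(6)[of a] by (simp add: U physical_def)
  qed
  moreover have "velocity_deviation L a l \<le> velocity_bound Rg \<gamma> \<mu> h L a" for a l
  proof (rule limit_satisfies_velocity_bound[where P = P and J = J and U = U])
    show "admissible Rg \<gamma> L"
      using init_density T'_pos by (simp add: admissible_def L_inverse)
    \<comment> \<open>The coefficient times the deviation is \<open>w a\<close> times the size of the velocity increment, which
      vanishes because the velocities converge.\<close>
    have "(\<lambda>m. w a * \<bar>velocity (U (Suc m) a) $ l - velocity (U m a) $ l\<bar>) \<longlonglongrightarrow> w a * \<bar>V' a l - V' a l\<bar>"
      using V_lim[of a l] by (intro tendsto_intros LIMSEQ_Suc) simp_all
    moreover have "w a * \<bar>velocity (U (Suc m) a) $ l - velocity (U m a) $ l\<bar>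
        = theta Rg \<gamma> \<mu> h P J (U m) $ l * velocity_deviation (U m) a l" for m
      using \<theta>(1)[of m l] w[of a] by (simp add: V velocity_deviation_def theta abs_mult)
    ultimately show
      "(\<lambda>m. theta Rg \<gamma> \<mu> h P J (U m) $ l * velocity_deviation (U m) a l) \<longlonglongrightarrow> 0"
      by simp
  qed (use assms(3-6) V_lim T_lim \<rho> in \<open>simp_all add: L_inverse\<close>)
  ultimately have "\<exists>Uhat_lim. (\<forall>a. (\<lambda>m. Uhat m a) \<longlonglongrightarrow> Uhat_lim a) \<and>
      (\<forall>a l. velocity_deviation (physical J Uhat_lim) a l
         \<le> velocity_bound Rg \<gamma> \<mu> h (physical J Uhat_lim) a)"
    by (intro exI[of _ Uhat_lim]) (simp add: phys)
  with conservative dissipative contraction show ?thesis by blast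
qed

end
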